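(* Let $K$ be an arbitrary wedge in $L^0$, and let $\emptyset\neq M\subseteq M_1=M_1(\mathbb P;K)$ be such that $\overline{\mathcal W(R(M))}^{\sigma(F,E)}=F\cap\mathcal W(R(M_1))$, respectively $R(M)^\lhd=c_E(K)$ (i.e. $M$ satisfies one of these two conditions). Let $X\in E$. Then the set $A_X(c_E(K))$ is bounded from below and $$\overline\pi(X;c_E(K))=\sup_{\mathbb Q\in M}\mathbb E_{\mathbb Q}[X].$$
   Context: $(\Omega,\mathcal F,\mathbb P)$ is a probability space and $L^0=L^0(\Omega,\mathcal F,\mathbb P)$ is the vector lattice of real random variables modulo $\mathbb P$-a.s. equality, ordered $\mathbb P$-a.s. For a probability measure $\mathbb Q\ll\mathbb P$, $L^1(\mathbb Q)$ is regarded as the set of $X\in L^0$ with $\mathbb E_{\mathbb Q}|X|<\infty$. A wedge in a real vector space is a non-empty convex set $C$ with $\lambda C\subseteq C$ for all $\lambda\ge0$. $\mathcal W(S)$ is the smallest wedge containing the non-empty set $S$, and $[S]$ is the linear span of $S$. $M_1=M_1(\mathbb P;K)$ is the set of all probability measures $\mathbb Q\ll\mathbb P$ such that $K\subseteq L^1(\mathbb Q)$ and $\mathbb E_{\mathbb Q}[X]\le0$ for all $X\in K$. $R(\mathbb Q):=\frac{d\mathbb Q}{d\mathbb P}\in L^1(\mathbb P)$. $E:=\bigcap_{\mathbb Q\in M}L^1(\mathbb Q)$ (a vector sublattice of $L^0$ containing $K$) and $F:=[R(M)]\subseteq L^1(\mathbb P)$, with bilinear form $\langle z,w\rangle:=\mathbb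 E_{\mathbb P}[zw]$ on $E\times F$ and associated weak topologies $\sigma(E,F)$, $\sigma(F,E)$. For non-empty $B\subseteq F$, $B^\lhd=\{z\in E:\langle z,w\rangle\le0\ \forall w\in B\}$. $s_E(K):=K-E_+=\{x\in E:x\le g\text{ for some }g\in K\}$ with $E_+=\{x\in E:x\ge0\}$, and $c_E(K):=\overline{s_E(K)}^{\sigma(E,F)}$. For $X\in E$ and a wedge $C\subseteq E$ containing $K$: $A_X(C):=\{x\in\mathbb R:X\le x+G\text{ for some }G\in C\}$ and the $M$-based super-replication price is $\overline\pi(X;C):=\inf A_X(C)$, with the convention $\inf\emptyset=+\infty$. *)

theory Defs
  imports "HOL-Probability.Probability"
begin

text \<open>
  The space \<open>L\<^sup>0(P)\<close> is handled through representatives: an element of it is given by a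
  \<open>P\<close>-measurable function, and a subset of it by the set of \<^emph>\<open>all\<close> representatives of its elements,
  that is, by a set of measurable functions closed under \<open>P\<close>-a.s. equality.  This is a bijection
  between subsets of the quotient and such saturated sets, and it respects inclusions,
  intersections, unions, hulls and closures.
\<close>

definition L0_set :: "'a measure \<Rightarrow> ('a \<Rightarrow> real) set \<Rightarrow> bool" where
  "L0_set P A \<longleftrightarrow> A \<subseteq> borel_measurable P \<and>
     (\<forall>X\<in>A. \<forall>Y\<in>borel_measurable P. (AE \<omega> in P. X \<omega> = Y \<omega>) \<longrightarrow> Y \<in> A)"

definition wedge :: "'a measure \<Rightarrow> ('a \<Rightarrow> real) set \<Rightarrow> bool" where
  "wedge P C \<longleftrightarrow> L0_set P C \<and> C \<noteq> {} \<and>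
     (\<forall>X\<in>C. \<forall>Y\<in>C. \<forall>t\<in>{0..1}. (\<lambda>\<omega>. (1 - t) * X \<omega> + t * Y \<omega>) \<in> C) \<and>
     (\<forall>X\<in>C. \<forall>c\<ge>0. (\<lambda>\<omega>. c * X \<omega>) \<in> C)"

definition lin_subspace :: "'a measure \<Rightarrow> ('a \<Rightarrow> real) set \<Rightarrow> bool" where
  "lin_subspace P V \<longleftrightarrow> L0_set P V \<and> V \<noteq> {} \<and>
     (\<forall>X\<in>V. \<forall>Y\<in>V. (\<lambda>\<omega>. X \<omega> + Y \<omega>) \<in> V) \<and>
     (\<forall>X\<in>V. \<forall>c. (\<lambda>\<omega>. c * X \<omega>) \<in> V)"

definition wedge_hull :: "'a measure \<Rightarrow> ('a \<Rightarrow> real) set \<Rightarrow> ('a \<Rightarrow> real) set" where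
  "wedge_hull P S = wedge P hull S"

definition lin_span :: "'a measure \<Rightarrow> ('a \<Rightarrow> real) set \<Rightarrow> ('a \<Rightarrow> real) set" where
  "lin_span P S = lin_subspace P hull S"

text \<open>\<open>integrable Q X\<close> is the condition \<open>X \<in> L\<^sup>1(Q)\<close>, i.e. finiteness of the \<open>Q\<close>-expectation of
  \<open>\<bar>X\<bar>\<close>, for measurable \<open>X\<close>.\<close>

definition M1 :: "'a measure \<Rightarrow> ('a \<Rightarrow> real) set \<Rightarrow> 'a measure set" where
  "M1 P K = {Q. prob_space Q \<and> sets Q = sets P \<and> absolutely_continuous P Q \<and>
     (\<forall>X\<in>K. integrable Q X \<and> (\<integral>\<omega>. X \<omega> \<partial>Q) \<le> 0)}"

text \<open>The image \<open>R(M)\<close>: all versions of the densities \<open>dQ/dP\<close> with \<open>Q \<in> M\<close>.\<close>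

definition densities :: "'a measure \<Rightarrow> 'a measure set \<Rightarrow> ('a \<Rightarrow> real) set" where
  "densities P M = {w \<in> borel_measurable P.
     \<exists>Q\<in>M. AE \<omega> in P. w \<omega> = enn2real (RN_deriv P Q \<omega>)}"

definition E_space :: "'a measure \<Rightarrow> 'a measure set \<Rightarrow> ('a \<Rightarrow> real) set" where
  "E_space P M = {X \<in> borel_measurable P. \<forall>Q\<in>M. integrable Q X}"

definition F_space :: "'a measure \<Rightarrow> 'a measure set \<Rightarrow> ('a \<Rightarrow> real) set" where
  "F_space P M = lin_span P (densities P M)"

definition pairing :: "'a measure \<Rightarrow> ('a \<Rightarrow> real) \<Rightarrow> ('a \<Rightarrow> real) \<Rightarrow> real" where
  "pairing P z w = (\<integral>\<omega>. z \<omega> * w \<omega> \<partial>P)"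

text \<open>The coarsest topology on \<open>A\<close> making \<open>x \<mapsto> b x y\<close> continuous for every \<open>y \<in> B\<close>.\<close>

definition weak_topology :: "('x \<Rightarrow> 'y \<Rightarrow> real) \<Rightarrow> 'x set \<Rightarrow> 'y set \<Rightarrow> 'x topology" where
  "weak_topology b A B = topology_generated_by {{x \<in> A. b x y \<in> U} |y U. y \<in> B \<and> open U}"

lemma topspace_weak_topology:
  assumes "B \<noteq> {}"
  shows "topspace (weak_topology b A B) = A"
  unfolding weak_topology_def topology_generated_by_topspace
proof
  show "A \<subseteq> \<Union> {{x \<in> A. b x y \<in> U} |y U. y \<in> B \<and> open U}"
  proof
    fix x assume "x \<in> A"
    obtain y where "y \<in> B" using assms by blast
    have "{x \<in> A. b x y \<in> UNIV} \<in> {{x \<in> A. b x y \<in> U} |y U. y \<in> B \<and> open U}"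
      using \<open>y\<in>B\<close> open_UNIV by blast
    then show "x \<in> \<Union> {{x \<in> A. b x y \<in> U} |y U. y \<in> B \<and> open U}" using \<open>x\<in>A\<close> by blast
  qed
qed auto

definition sigma_EF :: "'a measure \<Rightarrow> 'a measure set \<Rightarrow> ('a \<Rightarrow> real) topology" where
  "sigma_EF P M = weak_topology (\<lambda>z w. pairing P z w) (E_space P M) (F_space P M)"

definition sigma_FE :: "'a measure \<Rightarrow> 'a measure set \<Rightarrow> ('a \<Rightarrow> real) topology" where
  "sigma_FE P M = weak_topology (\<lambda>w z. pairing P z w) (F_space P M) (E_space P M)"

definition polar_E :: "'a measure \<Rightarrow> 'a measure set \<Rightarrow> ('a \<Rightarrow> real) set \<Rightarrow> ('a \<Rightarrow> real) set" where
  "polar_E P M B = {z \<in> E_space P M. \<forall>w\<in>B. pairing P z w \<le> 0}"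

definition s_E :: "'a measure \<Rightarrow> 'a measure set \<Rightarrow> ('a \<Rightarrow> real) set \<Rightarrow> ('a \<Rightarrow> real) set" where
  "s_E P M K = {x \<in> E_space P M. \<exists>g\<in>K. AE \<omega> in P. x \<omega> \<le> g \<omega>}"

lemma wedge_subset_E_space:
  assumes "wedge P K" "M \<subseteq> M1 P K"
  shows "K \<subseteq> E_space P M"
  using assms unfolding wedge_def L0_set_def E_space_def M1_def by blast

lemma s_E_eq_diff:
  assumes "wedge P K" "M \<subseteq> M1 P K"
  shows "s_E P M K = {\<lambda>\<omega>. g \<omega> - p \<omega> |g p. g \<in> K \<and> p \<in> E_space P M \<and> (AE \<omega> in P. 0 \<le> p \<omega>)}"
  (is "_ = ?R")
proof
  show "s_E P M K \<subseteq> ?R"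
  proof
    fix x assume "x \<in> s_E P M K"
    then obtain g where g: "x \<in> E_space P M" "g \<in> K" "AE \<omega> in P. x \<omega> \<le> g \<omega>" unfolding s_E_def by blast
    have "g \<in> E_space P M" using g wedge_subset_E_space[OF assms] by blast
    then have "(\<lambda>\<omega>. g \<omega> - x \<omega>) \<in> E_space P M" using g unfolding E_space_def by auto
    then show "x \<in> ?R" using g by (intro CollectI exI[of _ g] exI[of _ "\<lambda>\<omega>. g \<omega> - x \<omega>"]) auto
  qed
  show "?R \<subseteq> s_E P M K"
  proof
    fix x assume "x \<in> ?R"
    then obtain g p where gp: "x = (\<lambda>\<omega>. g \<omega> - p \<omega>)" "g \<in> K" "p \<in> E_space P M"
      "AE \<omega> in P. 0 \<le> p \<omega>" by blast
    have "g \<in> E_space P M" using gp(2) wedge_subset_E_space[OF assms] by blast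
    then have "x \<in> E_space P M" using gp(3) unfolding gp(1) E_space_def by auto
    moreover have "AE \<omega> in P. x \<omega> \<le> g \<omega>" using gp(4) unfolding gp(1) by auto
    ultimately show "x \<in> s_E P M K" using gp(2) unfolding s_E_def by blast
  qed
qed

definition c_E :: "'a measure \<Rightarrow> 'a measure set \<Rightarrow> ('a \<Rightarrow> real) set \<Rightarrow> ('a \<Rightarrow> real) set" where
  "c_E P M K = sigma_EF P M closure_of s_E P M K"

definition superrep_set :: "'a measure \<Rightarrow> ('a \<Rightarrow> real) \<Rightarrow> ('a \<Rightarrow> real) set \<Rightarrow> real set" where
  "superrep_set P X C = {x. \<exists>G\<in>C. AE \<omega> in P. X \<omega> \<le> x + G \<omega>}"

text \<open>The infimum is taken in the extended reals, so it is \<open>\<infinity>\<close> for the empty set.\<close>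

definition superrep_price :: "'a measure \<Rightarrow> ('a \<Rightarrow> real) \<Rightarrow> ('a \<Rightarrow> real) set \<Rightarrow> ereal" where
  "superrep_price P X C = Inf (ereal ` superrep_set P X C)"

end

theory Submission
  imports Defs
begin

text \<open>A number \<open>x\<close> dominates all expectations \<open>\<integral>X dQ\<close>, \<open>Q \<in> M\<close>, iff \<open>X - x\<close> lies in the polar of
  \<open>R(M)\<close>; so the superhedging duality holds as soon as this polar is \<open>c_E(K)\<close>. If instead
  \<open>\<W>(R(M))\<close> is dense in \<open>F \<inter> \<W>(R(M1))\<close>, separate \<open>z \<in> E\<close> outside \<open>c_E(K)\<close> from the cone \<open>s_E(K)\<close> by
  some \<open>w \<in> F\<close>. As \<open>s_E(K)\<close> contains \<open>K\<close> and \<open>-E\<^sub>+\<close>, after normalization \<open>w\<close> is a density of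
  a measure in \<open>M1\<close>, so denseness shows that \<open>z\<close> is not in the polar of \<open>R(M)\<close>. A basic weak
  neighbourhood involves only finitely many elements of \<open>F\<close>, hence a finite-dimensional separation
  theorem suffices.\<close>

section \<open>Separating a point from a cone in finitely many coordinates\<close>

text \<open>For small \<open>t\<close> the linear term dominates, so a negative \<open>p\<close>
  would make the expression negative. This turns minimality of a squared distance into a first-order
  inequality.\<close>

lemma nonneg_of_quadratic_perturbation:
  fixes p q :: real
  assumes "\<And>t. 0 < t \<Longrightarrow> t \<le> 1 \<Longrightarrow> 0 \<le> 2 * t * p + t\<^sup>2 * q"
  shows "0 \<le> p"
proof (rule ccontr)
  assume "\<not> 0 \<le> p"
  then have p: "p < 0" by simp
  \<comment> \<open>This choice gives \<open>t * q \<le> - p\<close>, hence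
    \<open>2 * p + t * q \<le> p < 0\<close>; adding 1 keeps the denominator positive.\<close>
  define t where "t = min 1 (- p / (\<bar>q\<bar> + 1))"
  have t: "0 < t" "t \<le> 1" using p by (auto simp: t_def intro: divide_neg_pos)
  have "t * (\<bar>q\<bar> + 1) \<le> - p / (\<bar>q\<bar> + 1) * (\<bar>q\<bar> + 1)"
    unfolding t_def by (intro mult_right_mono) auto
  then have "t * (\<bar>q\<bar> + 1) \<le> - p" by simp
  moreover have "t * q \<le> t * (\<bar>q\<bar> + 1)" using t by (intro mult_left_mono) auto
  ultimately have "2 * p + t * q < 0" using p by linarith
  then have "t * (2 * p + t * q) < 0" using t by (simp add: mult_pos_neg)
  then show False using assms[OF t] by (simp add: algebra_simps power2_eq_square)
qed

text \<open>The separating functional is \<open>z - y\<close>, where \<open>y\<close> is the projection of \<open>z\<close> onto the closure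
  of \<open>S\<close>, obtained as the limit of a minimizing sequence.\<close>

lemma convex_cone_separation:
  fixes S :: "('i \<Rightarrow> real) set"
  assumes "finite I" and "S \<noteq> {}"
    and add: "\<And>x y. x \<in> S \<Longrightarrow> y \<in> S \<Longrightarrow> (\<lambda>i. x i + y i) \<in> S"
    and scale: "\<And>c x. 0 \<le> c \<Longrightarrow> x \<in> S \<Longrightarrow> (\<lambda>i. c * x i) \<in> S"
    and "0 < \<epsilon>" and far: "\<And>x. x \<in> S \<Longrightarrow> \<epsilon> \<le> (\<Sum>i\<in>I. (x i - z i)\<^sup>2)"
  shows "\<exists>a. (\<forall>x\<in>S. (\<Sum>i\<in>I. a i * x i) \<le> 0) \<and> 0 < (\<Sum>i\<in>I. a i * z i)"
proof -
  define N where "N x = (\<Sum>i\<in>I. (x i - z i)\<^sup>2)" for x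
  define d where "d = (INF x\<in>S. N x)"
  have bdd: "bdd_below (N ` S)" using far unfolding N_def by (intro bdd_belowI2)
  have d_le: "d \<le> N x" if "x \<in> S" for x
    unfolding d_def using bdd that by (rule cINF_lower)
  have "\<epsilon> \<le> d" unfolding d_def using \<open>S \<noteq> {}\<close> far by (intro cINF_greatest) (auto simp: N_def)
  have "\<exists>x\<in>S. N x < d + inverse (real (Suc k))" for k
  proof -
    have "(INF x\<in>S. N x) < d + inverse (real (Suc k))" unfolding d_def by simp
    then show ?thesis using cINF_less_iff[OF \<open>S \<noteq> {}\<close> bdd] by blast
  qed
  then obtain x where xS: "x k \<in> S" and xN: "N (x k) < d + inverse (real (Suc k))" for k
    by metis
  \<comment> \<open>The parallelogram law: the midpoint of \<open>x k\<close> and \<open>x l\<close>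
    stays in the cone, so its squared distance to \<open>z\<close> is at least \<open>d\<close>.
    Near-minimizers are therefore close to each other in every coordinate of
    \<open>I\<close>.\<close>
  have parallelogram: "(\<Sum>i\<in>I. (x k i - x l i)\<^sup>2) \<le> 2 * inverse (real (Suc k)) + 2 * inverse (real (Suc l))"
    for k l
  proof -
    let ?m = "\<lambda>i. (1/2) * (x k i + x l i)"
    have "?m \<in> S" using scale[OF _ add[OF xS xS], of "1/2"] by simp
    then have "d \<le> N ?m" by (rule d_le)
    moreover have "(\<Sum>i\<in>I. (x k i - x l i)\<^sup>2) = 2 * N (x k) + 2 * N (x l) - 4 * N ?m"
      unfolding N_def sum_distrib_left sum.distrib[symmetric] sum_subtractf[symmetric]
      by (intro sum.cong refl) (simp add: power2_eq_square field_simps)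
    ultimately show ?thesis using xN[of k] xN[of l] by linarith
  qed
  have "Cauchy (\<lambda>k. x k i)" if "i \<in> I" for i
  proof (rule metric_CauchyI)
    fix e :: real assume "0 < e"
    then have "0 < e\<^sup>2 / 4" by simp
    then obtain n where n: "inverse (real (Suc n)) < e\<^sup>2 / 4" using reals_Archimedean by blast
    have "dist (x k i) (x l i) < e" if "k \<ge> n" "l \<ge> n" for k l
    proof -
      have "(x k i - x l i)\<^sup>2 \<le> (\<Sum>i\<in>I. (x k i - x l i)\<^sup>2)"
        using \<open>i \<in> I\<close> \<open>finite I\<close> by (intro member_le_sum) auto
      also note parallelogram
      also have "2 * inverse (real (Suc k)) + 2 * inverse (real (Suc l)) \<le>
          2 * inverse (real (Suc n)) + 2 * inverse (real (Suc n))"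
        using that by (intro add_mono mult_left_mono le_imp_inverse_le) auto
      also have "\<dots> < e\<^sup>2" using n by simp
      finally have "\<bar>x k i - x l i\<bar>\<^sup>2 < e\<^sup>2" by simp
      then show ?thesis using \<open>0 < e\<close> by (simp add: dist_real_def power2_less_imp_less)
    qed
    then show "\<exists>n. \<forall>k\<ge>n. \<forall>l\<ge>n. dist (x k i) (x l i) < e" by blast
  qed
  \<comment> \<open>With the implication inside the existential, a value can be chosen for every
    index; values outside \<open>I\<close> are arbitrary and do not enter \<open>N\<close>.\<close>
  then have "\<exists>y. i \<in> I \<longrightarrow> (\<lambda>k. x k i) \<longlonglongrightarrow> y" for i
    by (metis Cauchy_convergent convergent_def)
  then obtain y where y: "(\<lambda>k. x k i) \<longlonglongrightarrow> y i" if "i \<in> I" for i by metis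
  \<comment> \<open>The limit \<open>y\<close> need not lie in \<open>S\<close>, so lower bounds for
    \<open>N\<close> are proved along the sequence \<open>x k\<close> and passed to the limit. The
    affine form covers \<open>y\<close> itself, \<open>y + t v\<close> and
    \<open>(1 - t) y\<close>.\<close>
  have limN: "(\<lambda>k. N (\<lambda>i. c * x k i + v i)) \<longlonglongrightarrow> N (\<lambda>i. c * y i + v i)" for c v
    unfolding N_def by (intro tendsto_intros y)
  have "N y \<le> d"
  proof (rule LIMSEQ_le)
    show "(\<lambda>k. N (x k)) \<longlonglongrightarrow> N y" using limN[of 1 "\<lambda>_. 0"] by simp
    show "(\<lambda>k. d + inverse (real (Suc k))) \<longlonglongrightarrow> d"
      using tendsto_add[OF tendsto_const LIMSEQ_inverse_real_of_nat, of d] by simp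
    show "\<exists>n. \<forall>k\<ge>n. N (x k) \<le> d + inverse (real (Suc k))" using xN less_imp_le by blast
  qed
  define a where "a i = z i - y i" for i
  have expand: "N (\<lambda>i. y i + t * v i) = N y + 2 * t * (- (\<Sum>i\<in>I. a i * v i)) + t\<^sup>2 * (\<Sum>i\<in>I. (v i)\<^sup>2)"
    for t v
    unfolding N_def sum_distrib_left sum_negf[symmetric] sum.distrib[symmetric]
    by (intro sum.cong refl) (simp add: a_def power2_eq_square algebra_simps)
  \<comment> \<open>The variational inequality at \<open>y\<close>: if moving in direction
    \<open>v\<close> does not bring \<open>N\<close> below \<open>d\<close>, then \<open>v\<close>
    has non-positive product with \<open>a = z - y\<close>.\<close>
  have neg: "(\<Sum>i\<in>I. a i * v i) \<le> 0"
    if "\<And>t. 0 < t \<Longrightarrow> t \<le> 1 \<Longrightarrow> d \<le> N (\<lambda>i. y i + t * v i)" for v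
  proof -
    have "0 \<le> 2 * t * (- (\<Sum>i\<in>I. a i * v i)) + t\<^sup>2 * (\<Sum>i\<in>I. (v i)\<^sup>2)" if "0 < t" "t \<le> 1" for t
      using \<open>\<And>t. 0 < t \<Longrightarrow> t \<le> 1 \<Longrightarrow> d \<le> N (\<lambda>i. y i + t * v i)\<close>[OF that] \<open>N y \<le> d\<close>
      unfolding expand by linarith
    then have "0 \<le> - (\<Sum>i\<in>I. a i * v i)" by (rule nonneg_of_quadratic_perturbation)
    then show ?thesis by simp
  qed
  show ?thesis
  proof (intro exI[of _ a] conjI ballI)
    fix v assume v: "v \<in> S"
    show "(\<Sum>i\<in>I. a i * v i) \<le> 0"
    proof (rule neg)
      fix t :: real assume t: "0 < t"
      have "(\<lambda>i. 1 * x k i + t * v i) \<in> S" for k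
        using add[OF xS scale[OF _ v], of t k] t by simp
      then have "d \<le> N (\<lambda>i. 1 * x k i + t * v i)" for k by (rule d_le)
      then have "d \<le> N (\<lambda>i. 1 * y i + t * v i)" by (intro LIMSEQ_le_const[OF limN]) blast
      then show "d \<le> N (\<lambda>i. y i + t * v i)" by simp
    qed
  next
    \<comment> \<open>Shrinking \<open>y\<close> towards the origin is an admissible move in a cone
      as long as \<open>1 - t \<ge> 0\<close>. It yields that \<open>a\<close> has non-negative
      product with \<open>y\<close>, so the product of \<open>a\<close> with \<open>z\<close> is at
      least \<open>N y > 0\<close>.\<close>
    have "(\<Sum>i\<in>I. a i * - y i) \<le> 0"
    proof (rule neg)
      fix t :: real assume t: "0 < t" "t \<le> 1"
      have "(\<lambda>i. (1 - t) * x k i + 0) \<in> S" for k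
        using scale[OF _ xS, of "1 - t" k] t by simp
      then have "d \<le> N (\<lambda>i. (1 - t) * x k i + 0)" for k by (rule d_le)
      then have "d \<le> N (\<lambda>i. (1 - t) * y i + 0)" by (intro LIMSEQ_le_const[OF limN]) blast
      then show "d \<le> N (\<lambda>i. y i + t * - y i)" by (simp add: algebra_simps)
    qed
    moreover have "(\<Sum>i\<in>I. a i * z i) = N y - (\<Sum>i\<in>I. a i * - y i)"
      unfolding N_def sum_subtractf[symmetric]
      by (intro sum.cong refl) (simp add: a_def power2_eq_square algebra_simps)
    moreover have "d \<le> N y"
    proof (rule LIMSEQ_le_const)
      show "(\<lambda>k. N (x k)) \<longlonglongrightarrow> N y" using limN[of 1 "\<lambda>_. 0"] by simp
    qed (use d_le xS in blast)
    ultimately show "0 < (\<Sum>i\<in>I. a i * z i)" using \<open>0 < \<epsilon>\<close> \<open>\<epsilon> \<le> d\<close> by linarith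
  qed
qed

section \<open>Neighbourhoods and closed half-spaces in weak topologies\<close>

text \<open>Induction over the generation of open sets: an intersection unites the two finite test
  sets and takes the smaller radius, and a union inherits the data of a member containing
  \<open>z\<close>.\<close>

lemma openin_weak_topology_nhd:
  assumes "openin (weak_topology b A B) V" and "z \<in> V"
  obtains W \<epsilon> where "finite W" "W \<subseteq> B" "0 < \<epsilon>"
    "\<And>x. x \<in> A \<Longrightarrow> (\<And>y. y \<in> W \<Longrightarrow> \<bar>b x y - b z y\<bar> < \<epsilon>) \<Longrightarrow> x \<in> V"
proof -
  have "generate_topology_on {{x \<in> A. b x y \<in> U} |y U. y \<in> B \<and> open U} V"
    using assms(1) unfolding weak_topology_def openin_topology_generated_by_iff .
  then have "\<exists>W \<epsilon>. finite W \<and> W \<subseteq> B \<and> 0 < \<epsilon> \<and>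
      (\<forall>x\<in>A. (\<forall>y\<in>W. \<bar>b x y - b z y\<bar> < \<epsilon>) \<longrightarrow> x \<in> V)"
    using \<open>z \<in> V\<close>
  proof induction
    case Empty
    then show ?case by simp
  next
    case (Int V1 V2)
    then obtain W1 e1 W2 e2 where "finite W1" "W1 \<subseteq> B" "0 < e1"
      "\<forall>x\<in>A. (\<forall>y\<in>W1. \<bar>b x y - b z y\<bar> < e1) \<longrightarrow> x \<in> V1"
      "finite W2" "W2 \<subseteq> B" "0 < e2"
      "\<forall>x\<in>A. (\<forall>y\<in>W2. \<bar>b x y - b z y\<bar> < e2) \<longrightarrow> x \<in> V2" by blast
    then show ?case by (intro exI[of _ "W1 \<union> W2"] exI[of _ "min e1 e2"]) auto
  next
    case (UN k)
    then obtain V' where "V' \<in> k" "z \<in> V'" by blast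
    then show ?case using UN.IH by (meson UnionI)
  next
    case (Basis V)
    then obtain y U where V: "V = {x \<in> A. b x y \<in> U}" and "y \<in> B" "open U" by blast
    then obtain e where "0 < e" "\<And>r. dist r (b z y) < e \<Longrightarrow> r \<in> U"
      using Basis.prems unfolding open_dist by blast
    then show ?case using \<open>y \<in> B\<close> unfolding V
      by (intro exI[of _ "{y}"] exI[of _ e]) (auto simp: dist_real_def)
  qed
  then show thesis using that by meson
qed

text \<open>The complement in \<open>A\<close> is a subbasic open set, the preimage of the positive
  reals. This serves both \<open>sigma_EF\<close> and \<open>sigma_FE\<close>.\<close>

lemma closedin_weak_topology_nonpos:
  assumes "y \<in> B"
  shows "closedin (weak_topology b A B) {x \<in> A. b x y \<le> 0}"
proof -
  have top: "topspace (weak_topology b A B) = A" using assms by (intro topspace_weak_topology) blast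
  have "openin (weak_topology b A B) {x \<in> A. b x y \<in> {0<..}}"
    unfolding weak_topology_def using assms
    by (intro topology_generated_by_Basis) (auto intro!: exI[of _ y] exI[of _ "{0<..}"])
  moreover have "A - {x \<in> A. b x y \<le> 0} = {x \<in> A. b x y \<in> {0<..}}" by auto
  ultimately show ?thesis unfolding closedin_def top by auto
qed

section \<open>Linear spans and wedge hulls of random variables\<close>

lemma L0_set_Inter:
  assumes "\<A> \<noteq> {}" and "\<And>A. A \<in> \<A> \<Longrightarrow> L0_set P A"
  shows "L0_set P (\<Inter>\<A>)"
  using assms unfolding L0_set_def by blast

lemma L0_setD:
  assumes "L0_set P A" "x \<in> A" "y \<in> borel_measurable P" "AE \<omega> in P. x \<omega> = y \<omega>"
  shows "y \<in> A"
  using assms unfolding L0_set_def by blast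

lemma lin_subspace_measurable: "lin_subspace (P :: 'a measure) (borel_measurable P)"
proof -
  have "(\<lambda>_. 0) \<in> borel_measurable P" by simp
  then have "borel_measurable P \<noteq> ({} :: ('a \<Rightarrow> real) set)" by blast
  then show ?thesis unfolding lin_subspace_def L0_set_def by auto
qed

lemma lin_subspace_imp_wedge:
  assumes "lin_subspace P V"
  shows "wedge P V"
  using assms unfolding lin_subspace_def wedge_def by simp

text \<open>The closure conditions pass to intersections. The family being intersected is non-empty
  because it contains the whole space \<open>borel_measurable P\<close>, which also keeps the hull
  inside the measurable functions. The wedge hull is treated in the same way.\<close>

lemma lin_subspace_lin_span:
  assumes "S \<noteq> {}" and "S \<subseteq> borel_measurable P"
  shows "lin_subspace P (lin_span P S)"
proof -
  have borel: "borel_measurable P \<in> {t. lin_subspace P t \<and> S \<subseteq> t}"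
    using lin_subspace_measurable assms(2) by blast
  show ?thesis
    unfolding lin_subspace_def[of _ "lin_span P S"]
  proof (intro conjI ballI allI impI)
    show "L0_set P (lin_span P S)"
      unfolding lin_span_def hull_def using borel
      by (intro L0_set_Inter) (blast, simp add: lin_subspace_def)
    show "lin_span P S \<noteq> {}" using assms(1) hull_subset[of S "lin_subspace P"] unfolding lin_span_def by blast
  qed (simp_all add: lin_span_def hull_def lin_subspace_def)
qed

lemma wedge_wedge_hull:
  assumes "S \<noteq> {}" and "S \<subseteq> borel_measurable P"
  shows "wedge P (wedge_hull P S)"
proof -
  have borel: "borel_measurable P \<in> {t. wedge P t \<and> S \<subseteq> t}"
    using lin_subspace_imp_wedge[OF lin_subspace_measurable] assms(2) by blast
  show ?thesis
    unfolding wedge_def[of _ "wedge_hull P S"]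
  proof (intro conjI ballI allI impI)
    show "L0_set P (wedge_hull P S)"
      unfolding wedge_hull_def hull_def using borel
      by (intro L0_set_Inter) (blast, simp add: wedge_def)
    show "wedge_hull P S \<noteq> {}" using assms(1) hull_subset[of S "wedge P"] unfolding wedge_hull_def by blast
  qed (simp_all add: wedge_hull_def hull_def wedge_def)
qed

lemma wedge_scale: "wedge P C \<Longrightarrow> x \<in> C \<Longrightarrow> 0 \<le> c \<Longrightarrow> (\<lambda>\<omega>. c * x \<omega>) \<in> C"
  unfolding wedge_def by blast

lemma wedge_add:
  assumes "wedge P C" "x \<in> C" "y \<in> C"
  shows "(\<lambda>\<omega>. x \<omega> + y \<omega>) \<in> C"
proof -
  have "\<forall>t\<in>{0..1}. (\<lambda>\<omega>. (1 - t) * x \<omega> + t * y \<omega>) \<in> C"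
    using assms unfolding wedge_def by blast
  from bspec[OF this, of "1/2"] have "(\<lambda>\<omega>. (1 - 1/2) * x \<omega> + 1/2 * y \<omega>) \<in> C" by simp
  from wedge_scale[OF assms(1) this, of 2] show ?thesis by (simp add: algebra_simps)
qed

lemma wedge_zero:
  assumes "wedge P C"
  shows "(\<lambda>\<omega>. 0) \<in> C"
proof -
  obtain x where "x \<in> C" using assms unfolding wedge_def by blast
  then show ?thesis using wedge_scale[OF assms, of x 0] by simp
qed

section \<open>The dual pair of \<open>E\<close> and \<open>F\<close>\<close>

locale pricing_measures = prob_space P for P :: "'a measure" +
  fixes K :: "('a \<Rightarrow> real) set" and M :: "'a measure set"
  assumes wedge_K: "wedge P K" and M_nonempty: "M \<noteq> {}" and M_subset: "M \<subseteq> M1 P K"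
begin

abbreviation "E \<equiv> E_space P M"
abbreviation "F \<equiv> F_space P M"

lemma M_D:
  assumes "Q \<in> M"
  shows "prob_space Q" "sets Q = sets P" "absolutely_continuous P Q"
    "\<And>g. g \<in> K \<Longrightarrow> integrable Q g" "\<And>g. g \<in> K \<Longrightarrow> (\<integral>\<omega>. g \<omega> \<partial>Q) \<le> 0"
  using assms M_subset unfolding M1_def by auto

lemma AE_M: "Q \<in> M \<Longrightarrow> AE \<omega> in P. p \<omega> \<Longrightarrow> AE \<omega> in Q. p \<omega>"
  using M_D(2,3) by (metis absolutely_continuous_AE)

lemma E_D: "x \<in> E \<Longrightarrow> x \<in> borel_measurable P" "x \<in> E \<Longrightarrow> Q \<in> M \<Longrightarrow> integrable Q x"
  unfolding E_space_def by auto

lemma E_add: "x \<in> E \<Longrightarrow> y \<in> E \<Longrightarrow> (\<lambda>\<omega>. x \<omega> + y \<omega>) \<in> E"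
  and E_diff: "x \<in> E \<Longrightarrow> y \<in> E \<Longrightarrow> (\<lambda>\<omega>. x \<omega> - y \<omega>) \<in> E"
  and E_scale: "x \<in> E \<Longrightarrow> (\<lambda>\<omega>. c * x \<omega>) \<in> E"
  unfolding E_space_def by auto

text \<open>Bounded functions are integrable under every probability measure. They supply the test
  functions: the constants, and later an indicator detecting negative values of a
  functional.\<close>

lemma E_bounded:
  assumes "x \<in> borel_measurable P" "\<And>\<omega>. \<bar>x \<omega>\<bar> \<le> c"
  shows "x \<in> E"
  unfolding E_space_def
proof (intro CollectI conjI ballI)
  fix Q assume Q: "Q \<in> M"
  interpret Q: prob_space Q by (rule M_D(1)[OF Q])
  have "x \<in> borel_measurable Q" using assms(1) measurable_cong_sets[OF M_D(2)[OF Q] refl] by blast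
  then show "integrable Q x"
    using assms(2) by (intro Q.integrable_const_bound[of _ c]) auto
qed fact

lemma E_const: "(\<lambda>\<omega>. c) \<in> E"
  by (rule E_bounded[of _ "\<bar>c\<bar>"]) auto

text \<open>Change of measure by the Radon-Nikodym theorem, for an arbitrary real version
  \<open>w\<close> of the density. It translates statements about the pairing into statements about
  expectations under \<open>Q\<close>.\<close>

lemma
  assumes "Q \<in> M" "x \<in> E" "w \<in> borel_measurable P" "AE \<omega> in P. w \<omega> = enn2real (RN_deriv P Q \<omega>)"
  shows integrable_E_density: "integrable P (\<lambda>\<omega>. x \<omega> * w \<omega>)"
    and pairing_density: "pairing P x w = (\<integral>\<omega>. x \<omega> \<partial>Q)"
proof -
  interpret Q: prob_space Q using M_D(1)[OF assms(1)] .
  note x = E_D(1)[OF assms(2)] E_D(2)[OF assms(2,1)]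
  have int: "integrable P (\<lambda>\<omega>. enn2real (RN_deriv P Q \<omega>) * x \<omega>)"
    using RN_deriv_integrable[OF Q.sigma_finite_measure_axioms M_D(3,2)[OF assms(1)] x(1)] x(2)
    by simp
  have eq: "AE \<omega> in P. x \<omega> * w \<omega> = enn2real (RN_deriv P Q \<omega>) * x \<omega>" using assms(4) by auto
  show "integrable P (\<lambda>\<omega>. x \<omega> * w \<omega>)"
    using integrable_cong_AE[OF _ _ eq] int x(1) assms(3) by auto
  have "pairing P x w = (\<integral>\<omega>. enn2real (RN_deriv P Q \<omega>) * x \<omega> \<partial>P)"
    unfolding pairing_def using x(1) assms(3) by (intro integral_cong_AE eq) auto
  also have "\<dots> = (\<integral>\<omega>. x \<omega> \<partial>Q)"
    using RN_deriv_integral[OF Q.sigma_finite_measure_axioms M_D(3,2)[OF assms(1)] x(1)] by simp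
  finally show "pairing P x w = (\<integral>\<omega>. x \<omega> \<partial>Q)" .
qed

lemma densities_measurable: "densities P M \<subseteq> borel_measurable P"
  unfolding densities_def by auto

lemma densities_nonempty: "densities P M \<noteq> {}"
proof -
  obtain Q where "Q \<in> M" using M_nonempty by blast
  then have "(\<lambda>\<omega>. enn2real (RN_deriv P Q \<omega>)) \<in> densities P M" unfolding densities_def by auto
  then show ?thesis by blast
qed

lemma lin_subspace_F: "lin_subspace P F"
  unfolding F_space_def by (rule lin_subspace_lin_span[OF densities_nonempty densities_measurable])

lemma densities_subset_F: "densities P M \<subseteq> F"
  unfolding F_space_def lin_span_def by (rule hull_subset)

lemma F_measurable: "w \<in> F \<Longrightarrow> w \<in> borel_measurable P"
  using lin_subspace_F unfolding lin_subspace_def L0_set_def by blast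

text \<open>For fixed \<open>x\<close> the functions \<open>w\<close> with integrable product form a
  linear subspace containing the densities, hence containing their span. Additivity of
  \<open>pairing\<close> rests on this, since a non-integrable function has integral 0 by
  default.\<close>

lemma integrable_E_F:
  assumes "x \<in> E" "w \<in> F"
  shows "integrable P (\<lambda>\<omega>. x \<omega> * w \<omega>)"
proof -
  let ?V = "{w \<in> borel_measurable P. integrable P (\<lambda>\<omega>. x \<omega> * w \<omega>)}"
  note [measurable] = E_D(1)[OF assms(1)]
  have "L0_set P ?V"
    unfolding L0_set_def
  proof (intro conjI ballI impI)
    fix v u assume "v \<in> ?V" and [measurable]: "u \<in> borel_measurable P" and "AE \<omega> in P. v \<omega> = u \<omega>"
    then have [measurable]: "v \<in> borel_measurable P" and "AE \<omega> in P. x \<omega> * v \<omega> = x \<omega> * u \<omega>" by auto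
    then have "integrable P (\<lambda>\<omega>. x \<omega> * v \<omega>) \<longleftrightarrow> integrable P (\<lambda>\<omega>. x \<omega> * u \<omega>)"
      by (intro integrable_cong_AE) auto
    then show "u \<in> ?V" using \<open>v \<in> ?V\<close> by simp
  qed blast
  moreover have "(\<lambda>\<omega>. c * v \<omega>) \<in> ?V" if "v \<in> ?V" for v c
    using that integrable_mult_right[of c P "\<lambda>\<omega>. x \<omega> * v \<omega>"] by (auto simp: mult.left_commute)
  moreover have "(\<lambda>\<omega>. 0) \<in> ?V" by simp
  then have "?V \<noteq> {}" by blast
  ultimately have "lin_subspace P ?V"
    unfolding lin_subspace_def by (auto simp: distrib_left)
  moreover have "densities P M \<subseteq> ?V"
    using integrable_E_density[OF _ assms(1)] unfolding densities_def by blast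
  ultimately have "F \<subseteq> ?V" unfolding F_space_def lin_span_def by (intro hull_minimal)
  then show ?thesis using assms(2) by blast
qed

lemma pairing_add_left:
  "x \<in> E \<Longrightarrow> y \<in> E \<Longrightarrow> w \<in> F \<Longrightarrow> pairing P (\<lambda>\<omega>. x \<omega> + y \<omega>) w = pairing P x w + pairing P y w"
  unfolding pairing_def using integrable_E_F by (simp add: distrib_right)

lemma pairing_scale_left: "pairing P (\<lambda>\<omega>. c * x \<omega>) w = c * pairing P x w"
  unfolding pairing_def by (simp add: mult.assoc)

lemma pairing_add_right:
  "x \<in> E \<Longrightarrow> v \<in> F \<Longrightarrow> w \<in> F \<Longrightarrow> pairing P x (\<lambda>\<omega>. v \<omega> + w \<omega>) = pairing P x v + pairing P x w"
  unfolding pairing_def using integrable_E_F by (simp add: distrib_left)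

lemma pairing_scale_right: "pairing P x (\<lambda>\<omega>. c * w \<omega>) = c * pairing P x w"
  unfolding pairing_def by (simp add: mult.left_commute)

lemma pairing_cong_AE:
  assumes "x \<in> E" "v \<in> borel_measurable P" "w \<in> borel_measurable P" "AE \<omega> in P. v \<omega> = w \<omega>"
  shows "pairing P x v = pairing P x w"
  unfolding pairing_def using assms E_D(1)[OF assms(1)] by (intro integral_cong_AE) auto

lemma F_add: "v \<in> F \<Longrightarrow> w \<in> F \<Longrightarrow> (\<lambda>\<omega>. v \<omega> + w \<omega>) \<in> F"
  and F_scale: "w \<in> F \<Longrightarrow> (\<lambda>\<omega>. c * w \<omega>) \<in> F"
  using lin_subspace_F unfolding lin_subspace_def by blast+

lemma F_zero: "(\<lambda>\<omega>. 0) \<in> F"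
  using wedge_zero[OF lin_subspace_imp_wedge[OF lin_subspace_F]] .

text \<open>Membership and the pairing formula are proved together because additivity in the
  induction step uses that the partial sum already lies in \<open>F\<close>.\<close>

lemma linear_combination_F:
  assumes "finite W" "W \<subseteq> F"
  shows "(\<lambda>\<omega>. \<Sum>w\<in>W. a w * w \<omega>) \<in> F \<and>
    (\<forall>x\<in>E. pairing P x (\<lambda>\<omega>. \<Sum>w\<in>W. a w * w \<omega>) = (\<Sum>w\<in>W. a w * pairing P x w))"
  using assms
proof induction
  case empty
  then show ?case using F_zero by (simp add: pairing_def)
next
  case (insert v W)
  then show ?case
    using F_add[OF F_scale[of v "a v"]] pairing_add_right[OF _ F_scale[of v "a v"]]
    by (simp add: pairing_scale_right)
qed

section \<open>The cone \<open>s_E P M K\<close> and the functionals separating from its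
  closure\<close>

lemma K_subset_E: "K \<subseteq> E"
  by (rule wedge_subset_E_space[OF wedge_K M_subset])

lemma s_E_I: "x \<in> E \<Longrightarrow> g \<in> K \<Longrightarrow> AE \<omega> in P. x \<omega> \<le> g \<omega> \<Longrightarrow> x \<in> s_E P M K"
  unfolding s_E_def by (intro CollectI conjI bexI[of _ g])

lemma s_E_add: "x \<in> s_E P M K \<Longrightarrow> y \<in> s_E P M K \<Longrightarrow> (\<lambda>\<omega>. x \<omega> + y \<omega>) \<in> s_E P M K"
  and s_E_scale: "0 \<le> c \<Longrightarrow> x \<in> s_E P M K \<Longrightarrow> (\<lambda>\<omega>. c * x \<omega>) \<in> s_E P M K"
proof -
  assume "x \<in> s_E P M K" "y \<in> s_E P M K"
  then obtain g h where *: "x \<in> E" "g \<in> K" "AE \<omega> in P. x \<omega> \<le> g \<omega>"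
    "y \<in> E" "h \<in> K" "AE \<omega> in P. y \<omega> \<le> h \<omega>" unfolding s_E_def by blast
  have "AE \<omega> in P. x \<omega> + y \<omega> \<le> g \<omega> + h \<omega>" using *(3,6) by eventually_elim (rule add_mono)
  then show "(\<lambda>\<omega>. x \<omega> + y \<omega>) \<in> s_E P M K"
    by (rule s_E_I[OF E_add[OF *(1,4)] wedge_add[OF wedge_K *(2,5)]])
next
  assume c: "0 \<le> c" and "x \<in> s_E P M K"
  then obtain g where *: "x \<in> E" "g \<in> K" "AE \<omega> in P. x \<omega> \<le> g \<omega>" unfolding s_E_def by blast
  have "AE \<omega> in P. c * x \<omega> \<le> c * g \<omega>" using *(3) by eventually_elim (rule mult_left_mono[OF _ c])
  then show "(\<lambda>\<omega>. c * x \<omega>) \<in> s_E P M K"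
    by (rule s_E_I[OF E_scale[OF *(1)] wedge_scale[OF wedge_K *(2) c]])
qed

lemma nonpos_in_s_E: "x \<in> E \<Longrightarrow> AE \<omega> in P. x \<omega> \<le> 0 \<Longrightarrow> x \<in> s_E P M K"
  using s_E_I[of x "\<lambda>\<omega>. 0"] wedge_zero[OF wedge_K] by simp

lemma K_subset_s_E: "K \<subseteq> s_E P M K"
proof
  fix g assume "g \<in> K"
  then show "g \<in> s_E P M K" using K_subset_E by (intro s_E_I[of g g]) (simp_all add: subsetD)
qed

lemma topspace_sigma_EF: "topspace (sigma_EF P M) = E"
  unfolding sigma_EF_def using F_zero by (intro topspace_weak_topology) blast

text \<open>A neighbourhood of \<open>z\<close> missing the cone tests only a finite set
  \<open>W\<close>. In the coordinates given by \<open>W\<close> the image of the cone is again a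
  cone, at positive distance from the image of \<open>z\<close>; the separating coefficients
  assemble into a linear combination of \<open>W\<close>, which is an element of
  \<open>F\<close>.\<close>

lemma separation_c_E:
  assumes "z \<in> E" "z \<notin> c_E P M K"
  obtains w where "w \<in> F" "\<And>x. x \<in> s_E P M K \<Longrightarrow> pairing P x w \<le> 0" "0 < pairing P z w"
proof -
  obtain V where V: "z \<in> V" "openin (sigma_EF P M) V" "\<not> (\<exists>x. x \<in> s_E P M K \<and> x \<in> V)"
    using assms unfolding c_E_def in_closure_of topspace_sigma_EF by blast
  obtain W \<epsilon> where W: "finite W" "W \<subseteq> F" "0 < \<epsilon>"
    and near: "\<And>x. x \<in> E \<Longrightarrow> (\<And>w. w \<in> W \<Longrightarrow> \<bar>pairing P x w - pairing P z w\<bar> < \<epsilon>) \<Longrightarrow> x \<in> V"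
    using openin_weak_topology_nhd[OF V(2)[unfolded sigma_EF_def] V(1)] by metis
  \<comment> \<open>Outside \<open>W\<close> the pairing need not be additive, so the coordinates are cut off there.\<close>
  define T where "T x w = (if w \<in> W then pairing P x w else 0)" for x w
  have s_E_E: "x \<in> E" if "x \<in> s_E P M K" for x using that unfolding s_E_def by blast
  have "\<epsilon>\<^sup>2 \<le> (\<Sum>w\<in>W. (T x w - T z w)\<^sup>2)" if x: "x \<in> s_E P M K" for x
  proof -
    \<comment> \<open>Since \<open>x\<close> lies outside \<open>V\<close>, some coordinate of
      \<open>x\<close> differs from that of \<open>z\<close> by at least the radius; this single
      term bounds the squared distance from below.\<close>
    obtain w where w: "w \<in> W" "\<epsilon> \<le> \<bar>pairing P x w - pairing P z w\<bar>"
      using near[OF s_E_E[OF x]] V(3) x by (meson not_le)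
    have "\<epsilon>\<^sup>2 \<le> \<bar>pairing P x w - pairing P z w\<bar>\<^sup>2" using w(2) W(3) by (intro power_mono) auto
    also have "\<dots> = (T x w - T z w)\<^sup>2" using w(1) by (simp add: T_def)
    also have "\<dots> \<le> (\<Sum>w\<in>W. (T x w - T z w)\<^sup>2)" using w(1) W(1) by (intro member_le_sum) auto
    finally show ?thesis .
  qed
  then have far: "\<epsilon>\<^sup>2 \<le> (\<Sum>w\<in>W. (u w - T z w)\<^sup>2)" if "u \<in> T ` s_E P M K" for u
    using that by blast
  have add: "(\<lambda>w. u w + v w) \<in> T ` s_E P M K"
    if uv: "u \<in> T ` s_E P M K" "v \<in> T ` s_E P M K" for u v
  proof -
    obtain x y where xy: "x \<in> s_E P M K" "y \<in> s_E P M K" "u = T x" "v = T y" using uv by blast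
    have "(\<lambda>w. u w + v w) = T (\<lambda>\<omega>. x \<omega> + y \<omega>)"
      using pairing_add_left[OF s_E_E[OF xy(1)] s_E_E[OF xy(2)]] W(2) unfolding xy(3,4)
      by (auto simp: fun_eq_iff T_def)
    then show ?thesis using s_E_add[OF xy(1,2)] by blast
  qed
  have scale: "(\<lambda>w. c * u w) \<in> T ` s_E P M K" if cu: "0 \<le> c" "u \<in> T ` s_E P M K" for c u
  proof -
    obtain x where x: "x \<in> s_E P M K" "u = T x" using cu by blast
    have "(\<lambda>w. c * u w) = T (\<lambda>\<omega>. c * x \<omega>)" unfolding x(2) by (auto simp: fun_eq_iff T_def pairing_scale_left)
    then show ?thesis using s_E_scale[OF cu(1) x(1)] by blast
  qed
  have nonempty: "T ` s_E P M K \<noteq> {}" using K_subset_s_E wedge_zero[OF wedge_K] by blast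
  have "\<exists>a. (\<forall>u\<in>T ` s_E P M K. (\<Sum>w\<in>W. a w * u w) \<le> 0) \<and> 0 < (\<Sum>w\<in>W. a w * T z w)"
  proof (rule convex_cone_separation)
    show "0 < \<epsilon>\<^sup>2" using W(3) by simp
  qed (fact W(1) nonempty add scale far)+
  then obtain a where neg: "\<forall>u\<in>T ` s_E P M K. (\<Sum>w\<in>W. a w * u w) \<le> 0"
    and pos: "0 < (\<Sum>w\<in>W. a w * T z w)" by blast
  let ?w = "\<lambda>\<omega>. \<Sum>w\<in>W. a w * w \<omega>"
  have pair: "pairing P x ?w = (\<Sum>w\<in>W. a w * T x w)" if "x \<in> E" for x
    using linear_combination_F[OF W(1,2), of a] that by (simp add: T_def)
  show thesis
  proof
    show "?w \<in> F" using linear_combination_F[OF W(1,2)] by blast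
    show "pairing P x ?w \<le> 0" if "x \<in> s_E P M K" for x
      using bspec[OF neg imageI[OF that]] pair[OF s_E_E[OF that]] by simp
    show "0 < pairing P z ?w" using pos pair[OF assms(1)] by simp
  qed
qed

text \<open>Non-positivity on the negative functions in \<open>E\<close> forces \<open>w\<close> to
  be non-negative, and non-positivity on \<open>K\<close> makes the measure with density
  proportional to \<open>w\<close> an element of \<open>M1 P K\<close>.\<close>

lemma polar_s_E_in_wedge_hull:
  assumes "w \<in> F" and neg: "\<And>x. x \<in> s_E P M K \<Longrightarrow> pairing P x w \<le> 0"
  shows "w \<in> wedge_hull P (densities P (M1 P K))"
proof -
  note [measurable] = F_measurable[OF assms(1)]
  let ?D = "densities P (M1 P K)"
  have D: "?D \<noteq> {}" "?D \<subseteq> borel_measurable P"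
    using densities_nonempty M_subset unfolding densities_def by auto
  note hull = wedge_wedge_hull[OF D]
  have nn: "AE \<omega> in P. 0 \<le> w \<omega>"
  proof -
    \<comment> \<open>Minus the indicator of \<open>w < 0\<close>: the product with \<open>w\<close>
      is non-negative but has non-positive integral, so it vanishes a.s. and \<open>w\<close> is
      a.s. non-negative.\<close>
    define x where "x \<omega> = (if w \<omega> < 0 then - 1 else 0 :: real)" for \<omega>
    have x: "x \<in> E" unfolding x_def by (rule E_bounded[of _ 1]) auto
    then have "x \<in> s_E P M K" by (intro nonpos_in_s_E) (auto simp: x_def)
    then have "(\<integral>\<omega>. x \<omega> * w \<omega> \<partial>P) \<le> 0" using neg unfolding pairing_def by blast
    moreover have xw: "AE \<omega> in P. 0 \<le> x \<omega> * w \<omega>" by (auto simp: x_def)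
    ultimately have "(\<integral>\<omega>. x \<omega> * w \<omega> \<partial>P) = 0"
      using integral_nonneg_AE[OF xw] by linarith
    then have "AE \<omega> in P. x \<omega> * w \<omega> = 0"
      using integral_nonneg_eq_0_iff_AE[OF integrable_E_F[OF x assms(1)] xw] by blast
    then show ?thesis by eventually_elim (auto simp: x_def split: if_splits)
  qed
  have int: "integrable P w" using integrable_E_F[OF E_const[of 1] assms(1)] by simp
  define c where "c = (\<integral>\<omega>. w \<omega> \<partial>P)"
  have "0 \<le> c" unfolding c_def using nn by (rule integral_nonneg_AE)
  show ?thesis
  proof (cases "c = 0")
    \<comment> \<open>Without mass there is nothing to normalize, but then \<open>w\<close> is a
      version of 0, and the hull is closed under a.s. equality.\<close>
    case True
    then have "AE \<omega> in P. 0 = w \<omega>"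
      using integral_nonneg_eq_0_iff_AE[OF int nn] unfolding c_def by auto
    moreover have "L0_set P (wedge_hull P ?D)" using hull unfolding wedge_def by blast
    ultimately show ?thesis using L0_setD[OF _ wedge_zero[OF hull]] F_measurable[OF assms(1)] by blast
  next
    case False
    then have c: "0 < c" using \<open>0 \<le> c\<close> by simp
    \<comment> \<open>Truncation gives a version of \<open>w / c\<close> that is non-negative
      everywhere, so that \<open>ennreal\<close> loses no information.\<close>
    define f where "f \<omega> = max 0 (w \<omega> / c)" for \<omega>
    have [measurable]: "f \<in> borel_measurable P" unfolding f_def by measurable
    have fw: "AE \<omega> in P. f \<omega> = w \<omega> / c" using nn by eventually_elim (use c in \<open>auto simp: f_def\<close>)
    have f0: "0 \<le> f \<omega>" for \<omega> by (simp add: f_def)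
    define Q where "Q = density P (\<lambda>\<omega>. ennreal (f \<omega>))"
    have [simp]: "sets Q = sets P" unfolding Q_def by simp
    have "integrable P f"
      using integrable_cong_AE[OF _ _ fw] int by simp
    moreover have "(\<integral>\<omega>. f \<omega> \<partial>P) = 1"
    proof -
      have "(\<integral>\<omega>. f \<omega> \<partial>P) = (\<integral>\<omega>. w \<omega> / c \<partial>P)" by (intro integral_cong_AE fw) auto
      then show ?thesis using c by (simp add: c_def)
    qed
    ultimately have nn_f: "(\<integral>\<^sup>+\<omega>. ennreal (f \<omega>) \<partial>P) = 1"
      using f0 by (subst nn_integral_eq_integral) auto
    have "emeasure Q (space Q) = (\<integral>\<^sup>+\<omega>. ennreal (f \<omega>) * indicator (space P) \<omega> \<partial>P)"
      unfolding Q_def space_density by (intro emeasure_density) simp_all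
    also have "\<dots> = (\<integral>\<^sup>+\<omega>. ennreal (f \<omega>) \<partial>P)" by (intro nn_integral_cong) simp
    finally have "emeasure Q (space Q) = 1" unfolding nn_f .
    then have "prob_space Q" by (rule prob_spaceI)
    moreover have "absolutely_continuous P Q"
      unfolding Q_def by (rule absolutely_continuousI_density) simp
    moreover have "integrable Q g \<and> (\<integral>\<omega>. g \<omega> \<partial>Q) \<le> 0" if g: "g \<in> K" for g
    proof -
      have gE: "g \<in> E" using K_subset_E g by blast
      note [measurable] = E_D(1)[OF gE]
      have eq: "AE \<omega> in P. f \<omega> * g \<omega> = (g \<omega> * w \<omega>) / c" using fw by eventually_elim simp
      have "integrable P (\<lambda>\<omega>. (g \<omega> * w \<omega>) / c)" using integrable_E_F[OF gE assms(1)] by simp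
      then have "integrable P (\<lambda>\<omega>. f \<omega> * g \<omega>)" using integrable_cong_AE[OF _ _ eq] by simp
      then have "integrable Q g" unfolding Q_def by (subst integrable_real_density) (auto simp: f0)
      moreover have "(\<integral>\<omega>. g \<omega> \<partial>Q) = (\<integral>\<omega>. f \<omega> * g \<omega> \<partial>P)"
        unfolding Q_def by (subst integral_real_density) (auto simp: f0)
      moreover have "\<dots> = (\<integral>\<omega>. (g \<omega> * w \<omega>) / c \<partial>P)" by (intro integral_cong_AE eq) auto
      moreover have "\<dots> = pairing P g w / c" unfolding pairing_def by simp
      moreover have "pairing P g w \<le> 0" using neg K_subset_s_E g by blast
      ultimately show ?thesis using c by (simp add: divide_nonpos_pos)
    qed
    ultimately have "Q \<in> M1 P K" unfolding M1_def by simp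
    moreover have "AE \<omega> in P. w \<omega> / c = enn2real (RN_deriv P Q \<omega>)"
    proof -
      have "AE \<omega> in P. ennreal (f \<omega>) = RN_deriv P Q \<omega>"
        by (rule RN_deriv_unique) (auto simp: Q_def)
      with fw show ?thesis by eventually_elim (metis enn2real_ennreal f0)
    qed
    ultimately have "(\<lambda>\<omega>. w \<omega> / c) \<in> ?D" unfolding densities_def by auto
    then have "(\<lambda>\<omega>. w \<omega> / c) \<in> wedge_hull P ?D" unfolding wedge_hull_def by (rule hull_inc)
    from wedge_scale[OF hull this \<open>0 \<le> c\<close>] show ?thesis using c by simp
  qed
qed

section \<open>The polar of the densities and the closed cone \<open>c_E P M K\<close>\<close>

lemma mem_polar_iff:
  "z \<in> polar_E P M (densities P M) \<longleftrightarrow> z \<in> E \<and> (\<forall>Q\<in>M. (\<integral>\<omega>. z \<omega> \<partial>Q) \<le> 0)"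
proof -
  have "(\<forall>w\<in>densities P M. pairing P z w \<le> 0) \<longleftrightarrow> (\<forall>Q\<in>M. (\<integral>\<omega>. z \<omega> \<partial>Q) \<le> 0)" if z: "z \<in> E"
  proof (intro iffI ballI)
    fix Q assume *: "\<forall>w\<in>densities P M. pairing P z w \<le> 0" and Q: "Q \<in> M"
    let ?w = "\<lambda>\<omega>. enn2real (RN_deriv P Q \<omega>)"
    have "?w \<in> densities P M" unfolding densities_def using Q by auto
    then show "(\<integral>\<omega>. z \<omega> \<partial>Q) \<le> 0" using * pairing_density[OF Q z, of ?w] by auto
  next
    fix w assume "\<forall>Q\<in>M. (\<integral>\<omega>. z \<omega> \<partial>Q) \<le> 0" "w \<in> densities P M"
    then show "pairing P z w \<le> 0"
      using pairing_density[OF _ z] unfolding densities_def by fastforce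
  qed
  then show ?thesis unfolding polar_E_def by blast
qed

text \<open>Monotonicity of expectation carries non-positivity from \<open>K\<close> to
  \<open>s_E P M K\<close>, and each half-space defining the polar is closed.\<close>

lemma c_E_subset_polar: "c_E P M K \<subseteq> polar_E P M (densities P M)"
proof
  fix z assume z: "z \<in> c_E P M K"
  have "z \<in> {x \<in> E. pairing P x w \<le> 0}" if w: "w \<in> densities P M" for w
  proof -
    have "s_E P M K \<subseteq> {x \<in> E. pairing P x w \<le> 0}"
    proof
      fix x assume "x \<in> s_E P M K"
      then obtain g where g: "x \<in> E" "g \<in> K" "AE \<omega> in P. x \<omega> \<le> g \<omega>" unfolding s_E_def by blast
      have "(\<integral>\<omega>. x \<omega> \<partial>Q) \<le> 0" if Q: "Q \<in> M" for Q
      proof -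
        have "(\<integral>\<omega>. x \<omega> \<partial>Q) \<le> (\<integral>\<omega>. g \<omega> \<partial>Q)"
          using E_D(2)[OF g(1) Q] M_D(4)[OF Q g(2)] AE_M[OF Q g(3)] by (rule integral_mono_AE)
        then show ?thesis using M_D(5)[OF Q g(2)] by linarith
      qed
      then have "x \<in> polar_E P M (densities P M)" unfolding mem_polar_iff using g(1) by blast
      then show "x \<in> {x \<in> E. pairing P x w \<le> 0}" using w unfolding polar_E_def by blast
    qed
    moreover have "closedin (sigma_EF P M) {x \<in> E. pairing P x w \<le> 0}"
      unfolding sigma_EF_def using w densities_subset_F by (intro closedin_weak_topology_nonpos) blast
    ultimately have "c_E P M K \<subseteq> {x \<in> E. pairing P x w \<le> 0}"
      unfolding c_E_def by (rule closure_of_minimal)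
    then show ?thesis using z by blast
  qed
  then show "z \<in> polar_E P M (densities P M)" using densities_nonempty unfolding polar_E_def by blast
qed

text \<open>For fixed \<open>z\<close> the half-space of all \<open>w\<close> with non-positive
  pairing is a closed wedge containing the densities, hence it contains the closure of their wedge
  hull.\<close>

lemma pairing_closure_nonpos:
  assumes z: "z \<in> polar_E P M (densities P M)"
    and w: "w \<in> sigma_FE P M closure_of wedge_hull P (densities P M)"
  shows "pairing P z w \<le> 0"
proof -
  let ?H = "{w \<in> F. pairing P z w \<le> 0}"
  have zE: "z \<in> E" using z unfolding polar_E_def by blast
  have "wedge P ?H"
    unfolding wedge_def L0_set_def
  proof (intro conjI ballI allI impI)
    show "?H \<noteq> {}" using z densities_nonempty densities_subset_F unfolding polar_E_def by blast
  next
    fix u v :: "'a \<Rightarrow> real" and t :: real assume uv: "u \<in> ?H" "v \<in> ?H" and t: "t \<in> {0..1}"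
    have "(1 - t) * pairing P z u \<le> 0" "t * pairing P z v \<le> 0"
      using uv t by (auto simp: mult_nonneg_nonpos)
    then show "(\<lambda>\<omega>. (1 - t) * u \<omega> + t * v \<omega>) \<in> ?H"
      using uv F_add[OF F_scale F_scale, of u v "1 - t" t]
        pairing_add_right[OF zE F_scale F_scale, of u v "1 - t" t]
      by (simp add: pairing_scale_right)
  next
    fix u :: "'a \<Rightarrow> real" and c :: real assume "u \<in> ?H" "0 \<le> c"
    then show "(\<lambda>\<omega>. c * u \<omega>) \<in> ?H"
      using F_scale by (simp add: pairing_scale_right mult_nonneg_nonpos)
  next
    fix u v assume *: "u \<in> ?H" "v \<in> borel_measurable P" "AE \<omega> in P. u \<omega> = v \<omega>"
    then have "v \<in> F" using lin_subspace_F L0_setD unfolding lin_subspace_def by blast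
    then show "v \<in> ?H" using * pairing_cong_AE[OF zE F_measurable *(2,3)] by simp
  qed (use F_measurable in blast)
  moreover have "densities P M \<subseteq> ?H" using z densities_subset_F unfolding polar_E_def by blast
  ultimately have "wedge_hull P (densities P M) \<subseteq> ?H" unfolding wedge_hull_def by (intro hull_minimal)
  moreover have "closedin (sigma_FE P M) ?H"
    unfolding sigma_FE_def using zE by (rule closedin_weak_topology_nonpos)
  ultimately show ?thesis using w closure_of_minimal by blast
qed

text \<open>A bipolar argument reducing the first alternative of the theorem to the second.\<close>

lemma polar_eq_c_E:
  assumes "sigma_FE P M closure_of wedge_hull P (densities P M)
    = F \<inter> wedge_hull P (densities P (M1 P K))"
  shows "polar_E P M (densities P M) = c_E P M K"
proof (intro equalityI subsetI)
  fix z assume z: "z \<in> polar_E P M (densities P M)"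
  show "z \<in> c_E P M K"
  proof (rule ccontr)
    assume "z \<notin> c_E P M K"
    moreover have "z \<in> E" using z unfolding polar_E_def by blast
    ultimately obtain w where w: "w \<in> F" "\<And>x. x \<in> s_E P M K \<Longrightarrow> pairing P x w \<le> 0" "0 < pairing P z w"
      using separation_c_E by metis
    \<comment> \<open>The separating functional is a multiple of a density from
      \<open>M1 P K\<close> and lies in \<open>F\<close>; the hypothesis moves it into the closure
      generated by \<open>M\<close>, where its pairing with \<open>z\<close> cannot be
      positive.\<close>
    have "w \<in> sigma_FE P M closure_of wedge_hull P (densities P M)"
      unfolding assms using w(1) polar_s_E_in_wedge_hull[OF w(1,2)] by blast
    then show False using pairing_closure_nonpos[OF z] w(3) by fastforce
  qed
qed (use c_E_subset_polar in blast)

section \<open>Super-replication prices as upper bounds of expectations\<close>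

text \<open>Integrating the domination under \<open>Q\<close> gives one inclusion. For the other,
  the residual \<open>X - x\<close> is itself the hedge: it lies in \<open>E\<close>, which contains
  the constants, and its expectations are non-positive.\<close>

lemma superrep_set_polar:
  assumes X: "X \<in> E"
  shows "superrep_set P X (polar_E P M (densities P M)) = {x. \<forall>Q\<in>M. (\<integral>\<omega>. X \<omega> \<partial>Q) \<le> x}"
proof (intro equalityI subsetI CollectI ballI)
  fix x Q assume "x \<in> superrep_set P X (polar_E P M (densities P M))" and Q: "Q \<in> M"
  then obtain G where polar: "G \<in> polar_E P M (densities P M)" and le: "AE \<omega> in P. X \<omega> \<le> x + G \<omega>"
    unfolding superrep_set_def by blast
  then have G: "G \<in> E" "\<forall>Q\<in>M. (\<integral>\<omega>. G \<omega> \<partial>Q) \<le> 0" unfolding mem_polar_iff by blast+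
  interpret Q: prob_space Q using M_D(1)[OF Q] .
  have "(\<integral>\<omega>. X \<omega> \<partial>Q) \<le> (\<integral>\<omega>. x + G \<omega> \<partial>Q)"
    using E_D(2)[OF X Q] E_D(2)[OF G(1) Q] AE_M[OF Q le] by (intro integral_mono_AE) auto
  also have "\<dots> = x + (\<integral>\<omega>. G \<omega> \<partial>Q)" using E_D(2)[OF G(1) Q] by (simp add: Q.prob_space)
  also have "\<dots> \<le> x" using G(2) Q by simp
  finally show "(\<integral>\<omega>. X \<omega> \<partial>Q) \<le> x" .
next
  fix x assume x: "x \<in> {x. \<forall>Q\<in>M. (\<integral>\<omega>. X \<omega> \<partial>Q) \<le> x}"
  have "(\<integral>\<omega>. X \<omega> - x \<partial>Q) \<le> 0" if Q: "Q \<in> M" for Q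
  proof -
    interpret Q: prob_space Q using M_D(1)[OF Q] .
    show ?thesis using x Q E_D(2)[OF X Q] by (simp add: Q.prob_space)
  qed
  then have "(\<lambda>\<omega>. X \<omega> - x) \<in> polar_E P M (densities P M)"
    unfolding mem_polar_iff using E_diff[OF X E_const] by blast
  then show "x \<in> superrep_set P X (polar_E P M (densities P M))"
    unfolding superrep_set_def by (intro CollectI bexI[of _ "\<lambda>\<omega>. X \<omega> - x"]) auto
qed

end

text \<open>A finite supremum is itself one of the real upper bounds. The value \<infinity> makes
  the remaining inequality trivial, and minus infinity is excluded because some \<open>f i\<close>
  is a real lower bound of the supremum.\<close>

lemma Inf_ereal_upper_bounds:
  fixes f :: "'i \<Rightarrow> real"
  assumes "A \<noteq> {}"
  shows "Inf (ereal ` {x. \<forall>i\<in>A. f i \<le> x}) = (SUP i\<in>A. ereal (f i))"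
proof (rule antisym)
  show "(SUP i\<in>A. ereal (f i)) \<le> Inf (ereal ` {x. \<forall>i\<in>A. f i \<le> x})"
    by (intro SUP_least Inf_greatest) auto
  show "Inf (ereal ` {x. \<forall>i\<in>A. f i \<le> x}) \<le> (SUP i\<in>A. ereal (f i))"
  proof (cases "SUP i\<in>A. ereal (f i)")
    case (real r)
    have "ereal (f i) \<le> ereal r" if "i \<in> A" for i
      using SUP_upper[OF that, of "\<lambda>i. ereal (f i)"] real by simp
    then show ?thesis unfolding real by (intro Inf_lower) auto
  next
    case MInf
    obtain i where "i \<in> A" using assms by blast
    then show ?thesis using SUP_upper[of i A "\<lambda>i. ereal (f i)"] MInf by simp
  qed simp
qed

theorem corollary5p5:
  fixes P :: "'a measure"
    and K :: "('a \<Rightarrow> real) set"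
    and M :: "'a measure set"
    and X :: "'a \<Rightarrow> real"
  assumes "prob_space P"
    and "wedge P K"
    and "M \<noteq> {}" and "M \<subseteq> M1 P K"
    and "sigma_FE P M closure_of wedge_hull P (densities P M)
           = F_space P M \<inter> wedge_hull P (densities P (M1 P K))
         \<or> polar_E P M (densities P M) = c_E P M K"
    and "X \<in> E_space P M"
  shows "bdd_below (superrep_set P X (c_E P M K)) \<and>
         superrep_price P X (c_E P M K) = (SUP Q\<in>M. ereal (\<integral>\<omega>. X \<omega> \<partial>Q))"
proof -
  interpret prob_space P by fact
  interpret pricing_measures P K M by unfold_locales fact+
  have "polar_E P M (densities P M) = c_E P M K" using assms(5) polar_eq_c_E by blast
  then have eq: "superrep_set P X (c_E P M K) = {x. \<forall>Q\<in>M. (\<integral>\<omega>. X \<omega> \<partial>Q) \<le> x}"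
    using superrep_set_polar[OF assms(6)] by simp
  \<comment> \<open>The expectation under any single measure of \<open>M\<close> is a lower bound of
    the set.\<close>
  obtain Q where "Q \<in> M" using assms(3) by blast
  then have "bdd_below {x. \<forall>Q\<in>M. (\<integral>\<omega>. X \<omega> \<partial>Q) \<le> x}"
    by (intro bdd_belowI[of _ "\<integral>\<omega>. X \<omega> \<partial>Q"]) blast
  then show ?thesis
    unfolding superrep_price_def eq
    using Inf_ereal_upper_bounds[OF assms(3), of "\<lambda>Q. \<integral>\<omega>. X \<omega> \<partial>Q"] by blast
qed

end
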